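(* Let $G_1$ be a connected graph of order $m$ and let $G_2$ be a graph of order $n$ with $l\geq 1$ connected components $G_2^1, G_2^2,\ldots,G_2^l$, each having at least two vertices. Assume that $G_1$ and $G_2$ both have at least two vertices and both have non-trivial automorphism group. Then $$mn-1\;\geq\; fix(G_1[G_2])\;\geq\; m\left(\sum_{i=1}^{l} fix(G_2^i)\right).$$
   Context: All graphs are finite and simple. For a graph $G$, a set $\mathcal{F}\subseteq V(G)$ is a fixing set of $G$ if the only automorphism of $G$ that fixes every vertex of $\mathcal{F}$ is the identity (the empty set is a fixing set exactly when $G$ has trivial automorphism group). The fixing number $fix(G)$ is the minimum cardinality of a fixing set of $G$. The composition product (lexicographic product) $G_1[G_2]$ is the graph with vertex set $V(G_1)\times V(G_2)$ in which $(a,v)$ is adjacent to $(b,w)$ if and only if $ab\in E(G_1)$, or $a=b$ and $vw\in E(G_2)$. *)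

theory Defs
  imports "Graph_Theory.Digraph_Component" "HOL-Combinatorics.Permutations"
begin

text \<open>
  A finite simple graph is a \<^locale>\<open>graph\<close> of the Graph_Theory library: finite, loop-free, without
  parallel arcs and symmetric, so an undirected edge \<open>uv\<close> is the pair of arcs \<open>u\<close> to \<open>v\<close> and \<open>v\<close> to \<open>u\<close>,
  and \<open>u \<rightarrow>\<^bsub>G\<^esub> v\<close> is adjacency.
\<close>

text \<open>A component is a maximal connected subgraph; as a graph it has its own automorphisms.\<close>

definition components :: "('a, 'b) pre_digraph \<Rightarrow> ('a, 'b) pre_digraph set" where
  "components G = {H. pre_digraph.max_subgraph G connected H}"

text \<open>
  Automorphisms are normalised to be the identity outside \<^term>\<open>verts G\<close> (this is part of
  \<^const>\<open>permutes\<close>), so that the identity automorphism is exactly \<^const>\<open>id\<close>.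
\<close>

definition automorphisms :: "('a, 'b) pre_digraph \<Rightarrow> ('a \<Rightarrow> 'a) set" where
  "automorphisms G = {f. f permutes verts G \<and>
     (\<forall>u \<in> verts G. \<forall>v \<in> verts G. u \<rightarrow>\<^bsub>G\<^esub> v \<longleftrightarrow> f u \<rightarrow>\<^bsub>G\<^esub> f v)}"

definition fixing_set :: "('a, 'b) pre_digraph \<Rightarrow> 'a set \<Rightarrow> bool" where
  "fixing_set G F \<longleftrightarrow> F \<subseteq> verts G \<and>
     (\<forall>f \<in> automorphisms G. (\<forall>v \<in> F. f v = v) \<longrightarrow> f = id)"

text \<open>
  For finite \<open>G\<close> the minimum exists, since \<^term>\<open>verts G\<close> is a fixing set.
\<close>

definition fixing_number :: "('a, 'b) pre_digraph \<Rightarrow> nat" where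
  "fixing_number G = (LEAST k. \<exists>F. fixing_set G F \<and> card F = k)"

definition lex_product ::
  "('a, 'b) pre_digraph \<Rightarrow> ('c, 'd) pre_digraph \<Rightarrow> ('a \<times> 'c, ('a \<times> 'c) \<times> ('a \<times> 'c)) pre_digraph"
where
  "lex_product G H = \<lparr>
     verts = verts G \<times> verts H,
     arcs = {((a, v), (b, w)) | a v b w.
       a \<in> verts G \<and> b \<in> verts G \<and> v \<in> verts H \<and> w \<in> verts H \<and>
       (a \<rightarrow>\<^bsub>G\<^esub> b \<or> (a = b \<and> v \<rightarrow>\<^bsub>H\<^esub> w))},
     tail = fst,
     head = snd \<rparr>"

lemma id_in_automorphisms: "id \<in> automorphisms G"
  by (simp add: automorphisms_def permutes_id)

lemma fixing_set_verts: "fixing_set G (verts G)"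
  by (auto simp: fixing_set_def automorphisms_def fun_eq_iff permutes_def)

lemma dominates_lex_product:
  "(a, v) \<rightarrow>\<^bsub>lex_product G H\<^esub> (b, w) \<longleftrightarrow>
     a \<in> verts G \<and> b \<in> verts G \<and> v \<in> verts H \<and> w \<in> verts H \<and>
     (a \<rightarrow>\<^bsub>G\<^esub> b \<or> (a = b \<and> v \<rightarrow>\<^bsub>H\<^esub> w))"
  by (force simp: lex_product_def arcs_ends_def arc_to_ends_def)

lemma graph_lex_product:
  assumes "graph G" "graph H"
  shows "graph (lex_product G H)"
proof -
  interpret G: graph G by fact
  interpret H: graph H by fact
  let ?P = "lex_product G H"
  have wf: "wf_digraph ?P"
    by unfold_locales (auto simp: lex_product_def)
  have fin: "finite (verts ?P)"
    by (simp add: lex_product_def)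
  have "arcs ?P \<subseteq> verts ?P \<times> verts ?P"
    by (auto simp: lex_product_def)
  then have fin_arcs: "finite (arcs ?P)"
    using fin by (meson finite_SigmaI finite_subset)
  have irrefl: "\<not> a \<rightarrow>\<^bsub>G\<^esub> a" "\<not> v \<rightarrow>\<^bsub>H\<^esub> v" for a v
    using G.adj_not_same H.adj_not_same by blast+
  have loopfree: "tail ?P e \<noteq> head ?P e" if "e \<in> arcs ?P" for e
    using that irrefl by (auto simp: lex_product_def)
  have nomulti: "e = e'" if "arc_to_ends ?P e = arc_to_ends ?P e'" for e e'
    using that by (simp add: lex_product_def arc_to_ends_def prod_eq_iff)
  have symm: "symmetric ?P"
    unfolding symmetric_def
  proof (rule symI)
    fix x y assume "x \<rightarrow>\<^bsub>?P\<^esub> y"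
    then show "y \<rightarrow>\<^bsub>?P\<^esub> x"
      by (cases x, cases y)
        (auto simp: dominates_lex_product dest: G.graph_symmetric H.graph_symmetric)
  qed
  interpret P: wf_digraph ?P by (fact wf)
  show ?thesis
    by unfold_locales (use fin fin_arcs loopfree nomulti symm in auto)
qed

end

theory Submission
  imports Defs
begin

text \<open>
  Moving the vertices inside a single copy of a single component of the second factor by an
  automorphism of that component is an automorphism of the product.  Hence a fixing set of the
  product meets every copy of every component in a fixing set of that component, and these copies
  are pairwise disjoint.
\<close>

lemma fixing_number_le: "fixing_set G F \<Longrightarrow> fixing_number G \<le> card F"
  unfolding fixing_number_def by (rule Least_le) blast

lemma fixing_number_attained:
  obtains F where "fixing_set G F" "card F = fixing_number G"
proof -
  have "\<exists>F. fixing_set G F \<and> card F = fixing_number G"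
    unfolding fixing_number_def by (rule LeastI_ex) (use fixing_set_verts in blast)
  then show ?thesis using that by blast
qed

text \<open>By injectivity, a permutation cannot move exactly one point. This is what gives the
  upper bound \<open>m * n - 1\<close>.\<close>

lemma fixing_set_verts_minus:
  "fixing_set G (verts G - {x})"
proof (unfold fixing_set_def, intro conjI ballI impI)
  fix f assume "f \<in> automorphisms G" and fix_f: "\<forall>v \<in> verts G - {x}. f v = v"
  then have perm: "f permutes verts G"
    by (simp add: automorphisms_def)
  have "f v = v" if "v \<noteq> x" for v
    using that fix_f perm by (cases "v \<in> verts G") (auto simp: permutes_not_in)
  moreover from this have "f x = x"
    using permutes_inj[OF perm] by (metis injD)
  ultimately show "f = id" by (metis eq_id_iff)
qed simp

lemma strongly_connected_imp_connected:
  assumes "strongly_connected G"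
  shows "connected G"
proof -
  have "arcs_ends G \<subseteq> parcs (mk_symmetric G)"
    by (auto simp: parcs_mk_symmetric arcs_ends_conv)
  then have "u \<rightarrow>\<^sup>*\<^bsub>mk_symmetric G\<^esub> v" if "u \<rightarrow>\<^sup>*\<^bsub>G\<^esub> v" for u v
    using that unfolding reachable_def by (auto intro: rtrancl_on_mono)
  then show ?thesis
    using assms by (simp add: connected_def strongly_connected_def)
qed

text \<open>Serves to show that a maximal connected subgraph is induced: any further arc of
  \<open>G\<close> between its vertices could be added without losing connectedness.\<close>

lemma arc_mono_connected: "arc_mono connected"
  unfolding arc_mono_def
  by (metis spanning_def subgraphE wf_digraph.connected_spanning_imp_connected)

text \<open>A component is induced, so it inherits symmetry, and in a symmetric digraph connected
  means strongly connected. Maximality survives because the strongly connected subgraphs are among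
  the connected ones. Facts about \<open>sccs\<close>, such as disjointness, thereby apply to
  components.\<close>

lemma (in sym_digraph) components_subset_sccs: "components G \<subseteq> sccs"
proof
  fix H assume "H \<in> components G"
  then have H: "max_subgraph connected H" by (simp add: components_def)
  then have ind: "induced_subgraph H G"
    using arc_mono_connected by (rule induced_subgraphI_arc_mono)
  have "symmetric H"
    using sym_arcs ind by (rule induced_graph_imp_symmetric)
  moreover have "wf_digraph H" using subgraphI_max_subgraph[OF H] by (rule subgraphE)
  ultimately have "strongly_connected H"
    using wf_digraph.symmetric_connected_imp_strongly_connected max_subgraph_prop[OF H] by blast
  then have "max_subgraph strongly_connected H"
    using max_subgraph_mp[OF H strongly_connected_imp_connected] by blast
  then show "H \<in> sccs" by (simp add: sccs_altdef2)
qed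

text \<open>No arc of \<open>G\<close> crosses the boundary of \<open>H\<close>, and the
  normalisation makes an automorphism of \<open>H\<close> the identity outside
  \<open>verts H\<close>, so it serves as its own extension to \<open>G\<close>.\<close>

lemma (in sym_digraph) automorphisms_component:
  assumes H: "H \<in> components G"
  shows "automorphisms H \<subseteq> automorphisms G"
proof
  fix g assume g: "g \<in> automorphisms H"
  have scc: "H \<in> sccs" using H components_subset_sccs by blast
  then have ind: "induced_subgraph H G" by (rule in_sccs_imp_induced)
  then have sub: "verts H \<subseteq> verts G" by auto
  have perm: "g permutes verts H" using g by (simp add: automorphisms_def)
  have adj: "u \<rightarrow>\<^bsub>H\<^esub> v \<longleftrightarrow> u \<rightarrow>\<^bsub>G\<^esub> v" if "u \<in> verts H" "v \<in> verts H" for u v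
    using that ind
    by (auto simp: induced_subgraph_def subgraph_def compatible_def arcs_ends_conv)
  have "verts H \<in> sccs_verts" using scc by (simp add: sccs_verts_conv)
  \<comment> \<open>Such an arc and its reverse would make \<open>u\<close> and \<open>v\<close>
    mutually reachable, forcing \<open>v\<close> into the same strong component.\<close>
  then have no_arc: "\<not> u \<rightarrow>\<^bsub>G\<^esub> v" if "u \<in> verts H" "v \<notin> verts H" for u v
    using that reachable_adjI[of u v] reachable_adjI[of v u] graph_symmetric[of u v]
    unfolding in_sccs_verts_conv_reachable by blast
  have g_in: "g u \<in> verts H \<longleftrightarrow> u \<in> verts H" for u
    using perm by (rule permutes_in_image)
  have "u \<rightarrow>\<^bsub>G\<^esub> v \<longleftrightarrow> g u \<rightarrow>\<^bsub>G\<^esub> g v" for u v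
  proof (cases "u \<in> verts H \<and> v \<in> verts H")
    case True
    then have "u \<rightarrow>\<^bsub>H\<^esub> v \<longleftrightarrow> g u \<rightarrow>\<^bsub>H\<^esub> g v"
      using g unfolding automorphisms_def by blast
    with True show ?thesis using adj[of u v] adj[of "g u" "g v"] g_in by blast
  next
    case False
    have no_arc': "\<not> u \<rightarrow>\<^bsub>G\<^esub> v" if "u \<notin> verts H" "v \<in> verts H" for u v
      using that no_arc[of v u] graph_symmetric[of u v] by blast
    show ?thesis
    proof (cases "u \<in> verts H \<or> v \<in> verts H")
      \<comment> \<open>Exactly one of \<open>u\<close>, \<open>v\<close> lies in \<open>H\<close>,
        and the same holds for their images, so both adjacencies fail.\<close>
      case True
      with False show ?thesis using no_arc no_arc' g_in by meson
    next
      case False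
      then show ?thesis using permutes_not_in[OF perm] by simp
    qed
  qed
  then show "g \<in> automorphisms G"
    using permutes_subset[OF perm sub] unfolding automorphisms_def by blast
qed

definition fibre_map :: "'a \<Rightarrow> ('c \<Rightarrow> 'c) \<Rightarrow> 'a \<times> 'c \<Rightarrow> 'a \<times> 'c" where
  "fibre_map a h = (\<lambda>(x, v). (x, if x = a then h v else v))"

text \<open>Adjacency between different fibres depends only on the first coordinates, which are
  kept; within the fibre over \<open>a\<close> it is adjacency in \<open>H\<close>, which
  \<open>h\<close> preserves.\<close>

lemma fibre_map_automorphism:
  assumes a: "a \<in> verts G" and h: "h \<in> automorphisms H"
  shows "fibre_map a h \<in> automorphisms (lex_product G H)"
proof -
  have perm: "h permutes verts H" using h by (simp add: automorphisms_def)
  have h_in: "h u \<in> verts H \<longleftrightarrow> u \<in> verts H" for u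
    using perm by (rule permutes_in_image)
  have "fibre_map a (inv h) (fibre_map a h p) = p" "fibre_map a h (fibre_map a (inv h) p) = p" for p
    by (auto simp: fibre_map_def permutes_inverses[OF perm] split: prod.splits)
  then have "bij (fibre_map a h)"
    by (intro o_bij[of "fibre_map a (inv h)"]) (auto simp: fun_eq_iff)
  \<comment> \<open>Either the first coordinate is no vertex of \<open>G\<close> and so differs from
    \<open>a\<close>, or the second lies outside \<open>verts H\<close>, where \<open>h\<close> is
    the identity.\<close>
  moreover have "fibre_map a h p = p" if "p \<notin> verts (lex_product G H)" for p
    using that a permutes_not_in[OF perm]
    by (auto simp: fibre_map_def lex_product_def split: prod.splits)
  ultimately have "fibre_map a h permutes verts (lex_product G H)"
    by (auto simp: permutes_def bij_iff)
  moreover have "v \<rightarrow>\<^bsub>H\<^esub> w \<longleftrightarrow> h v \<rightarrow>\<^bsub>H\<^esub> h w" if "v \<in> verts H" "w \<in> verts H" for v w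
    using that h unfolding automorphisms_def by blast
  then have "(x, v) \<rightarrow>\<^bsub>lex_product G H\<^esub> (y, w) \<longleftrightarrow>
      fibre_map a h (x, v) \<rightarrow>\<^bsub>lex_product G H\<^esub> fibre_map a h (y, w)" for x v y w
    using h_in by (simp add: fibre_map_def dominates_lex_product) blast
  ultimately show ?thesis
    unfolding automorphisms_def by (simp add: split_paired_all)
qed

lemma fixing_set_component_fibre:
  assumes F: "fixing_set (lex_product G1 G2) F" and G2: "graph G2"
    and a: "a \<in> verts G1" and H: "H \<in> components G2"
  shows "fixing_set H {v \<in> verts H. (a, v) \<in> F}"
proof (unfold fixing_set_def, intro conjI ballI impI)
  interpret G2: graph G2 by fact
  fix g assume g: "g \<in> automorphisms H"
    and fix_g: "\<forall>v \<in> {v \<in> verts H. (a, v) \<in> F}. g v = v"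
  have perm: "g permutes verts H" using g by (simp add: automorphisms_def)
  have "fibre_map a g \<in> automorphisms (lex_product G1 G2)"
    using a g G2.automorphisms_component[OF H] by (blast intro: fibre_map_automorphism)
  \<comment> \<open>A point of \<open>F\<close> over \<open>a\<close> has its second coordinate
    either in the given trace, fixed by assumption, or outside \<open>verts H\<close>, where
    \<open>g\<close> is the identity.\<close>
  moreover have "fibre_map a g p = p" if "p \<in> F" for p
    using that fix_g permutes_not_in[OF perm] by (cases p) (auto simp: fibre_map_def)
  ultimately have "fibre_map a g = id" using F by (simp add: fixing_set_def)
  then have "fibre_map a g (a, v) = (a, v)" for v by simp
  then show "g = id" by (auto simp: fibre_map_def)
qed auto


theorem theorem2p13:
  fixes G1 :: "('a, 'b) pre_digraph" and G2 :: "('c, 'd) pre_digraph"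
    and C :: "nat \<Rightarrow> ('c, 'd) pre_digraph" and m n l :: nat
  assumes "graph G1" and "connected G1" and "card (verts G1) = m"
    and "graph G2" and "card (verts G2) = n"
    and "l \<ge> 1" and "bij_betw C {1..l} (components G2)"
    and "\<And>i. i \<in> {1..l} \<Longrightarrow> card (verts (C i)) \<ge> 2"
    and "m \<ge> 2" and "n \<ge> 2"
    and "automorphisms G1 \<noteq> {id}" and "automorphisms G2 \<noteq> {id}"
  shows "m * n - 1 \<ge> fixing_number (lex_product G1 G2) \<and>
    fixing_number (lex_product G1 G2) \<ge> m * (\<Sum>i=1..l. fixing_number (C i))"
proof
  let ?P = "lex_product G1 G2"
  interpret G1: graph G1 by fact
  interpret G2: graph G2 by fact
  have fin_P: "finite (verts ?P)" by (simp add: lex_product_def)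
  have card_P: "card (verts ?P) = m * n"
    using assms(3,5) by (simp add: lex_product_def card_cartesian_product)
  have "verts ?P \<noteq> {}" using card_P \<open>m \<ge> 2\<close> \<open>n \<ge> 2\<close> by force
  then obtain x where "x \<in> verts ?P" by blast
  then show "m * n - 1 \<ge> fixing_number ?P"
    using fixing_number_le[OF fixing_set_verts_minus, of ?P x] card_P fin_P by simp

  obtain F where F: "fixing_set ?P F" and card_F: "card F = fixing_number ?P"
    by (rule fixing_number_attained)
  then have fin_F: "finite F" using fin_P finite_subset unfolding fixing_set_def by blast
  \<comment> \<open>The trace of \<open>F\<close> on the copy over \<open>a\<close> of the component
    \<open>C i\<close>.\<close>
  define S where "S = (\<lambda>(a, i). {v \<in> verts (C i). (a, v) \<in> F})"
  let ?I = "verts G1 \<times> {1..l}"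
  have comp: "C i \<in> components G2" if "i \<in> {1..l}" for i
    using assms(7) that by (rule bij_betw_apply)
  have fin_S: "finite (S p)" for p
    using finite_subset[OF _ finite_imageI[OF fin_F, of snd], of "S p"]
    by (force simp: S_def split: prod.splits)
  have "i = j" if "i \<in> {1..l}" "j \<in> {1..l}" "v \<in> verts (C i)" "v \<in> verts (C j)" for i j v
  proof -
    have "C i \<in> G2.sccs" "C j \<in> G2.sccs"
      using comp that G2.components_subset_sccs by blast+
    then have "C i = C j" using G2.scc_disj that by blast
    then show ?thesis using assms(7) that by (meson bij_betw_imp_inj_on inj_onD)
  qed
  then have inj: "inj_on (\<lambda>((a, i), v). (a, v)) (Sigma ?I S)"
    by (auto simp: inj_on_def S_def)
  \<comment> \<open>The factor \<open>m\<close> is a sum over \<open>verts G1\<close> of a term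
    independent of \<open>a\<close>.\<close>
  have "m * (\<Sum>i=1..l. fixing_number (C i)) = (\<Sum>(a, i)\<in>?I. fixing_number (C i))"
    using assms(3) by (simp flip: sum.cartesian_product)
  also have "\<dots> \<le> (\<Sum>p\<in>?I. card (S p))"
  proof (rule sum_mono)
    fix p assume "p \<in> ?I"
    then obtain a i where p: "p = (a, i)" and "a \<in> verts G1" "i \<in> {1..l}" by blast
    then have "fixing_set (C i) (S p)"
      using fixing_set_component_fibre[OF F assms(4)] comp by (simp add: S_def)
    then show "(case p of (a, i) \<Rightarrow> fixing_number (C i)) \<le> card (S p)"
      by (simp add: p fixing_number_le)
  qed
  also have "\<dots> = card (Sigma ?I S)" using fin_S by simp
  \<comment> \<open>Dropping the index maps the disjoint union of the traces injectively into
    \<open>F\<close>.\<close>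
  also have "\<dots> \<le> card F"
    by (intro card_inj_on_le[OF inj _ fin_F]) (auto simp: S_def)
  finally show "fixing_number ?P \<ge> m * (\<Sum>i=1..l. fixing_number (C i))"
    using card_F by simp
qed

end
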